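(* Let $\varrho:[0,1]\to\mathbb R$. Then the assignment $\mathcal W_0\ni W\mapsto\varrho(W)\in\mathcal W$, where $\varrho$ is applied pointwise, is continuous with respect to the cut norm $\|\cdot\|_\square$ if and only if $\varrho$ is linear, i.e. of the form $\varrho(x)=ax+b$ with $a,b\in\mathbb R$.
   Context: A kernel is a bounded symmetric measurable function $W:[0,1]^2\to\mathbb R$; $\mathcal W$ is the space of kernels, and $\mathcal W_0\subset\mathcal W$ the set of graphons, i.e. kernels with values in $[0,1]$. The cut norm is $\|W\|_\square=\sup_{S,T\subseteq[0,1]}\left|\int_{S\times T}W\,d\lambda^2\right|$ over measurable $S,T$. It is implicit that $\varrho$ is such that $\varrho(W)=\varrho\circ W$ is a kernel for every graphon $W$, so that the assignment is well defined. *)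

theory Defs
  imports "HOL-Analysis.Analysis"
begin

text \<open>
  Functions on the unit square are represented by total functions on \<^typ>\<open>real \<times> real\<close>; none of the
  notions below depends on their values outside \<open>unit_square\<close>. Measurable means Lebesgue measurable.
  Functions that agree almost everywhere are not identified, so the cut norm is only a seminorm.
\<close>

definition unit_square :: "(real \<times> real) set" where
  "unit_square = {0..1} \<times> {0..1}"

definition kernels :: "(real \<times> real \<Rightarrow> real) set" where
  "kernels = {W. W \<in> borel_measurable (lebesgue_on unit_square)
                 \<and> bounded (W ` unit_square)
                 \<and> (\<forall>x\<in>{0..1}. \<forall>y\<in>{0..1}. W (x, y) = W (y, x))}"

definition graphons :: "(real \<times> real \<Rightarrow> real) set" where
  "graphons = {W \<in> kernels. \<forall>z\<in>unit_square. W z \<in> {0..1}}"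

text \<open>The supremum is taken in \<^typ>\<open>real\<close>; it is over a nonempty set, bounded above when \<open>W\<close> is a kernel.\<close>

definition cut_norm :: "(real \<times> real \<Rightarrow> real) \<Rightarrow> real" where
  "cut_norm W =
     (SUP (S, T) \<in> {(S, T). S \<in> sets lebesgue \<and> S \<subseteq> {0..1} \<and> T \<in> sets lebesgue \<and> T \<subseteq> {0..1}}.
        \<bar>LINT z:S \<times> T|lebesgue. W z\<bar>)"

text \<open>
  Continuity with respect to the pseudometric induced by the cut norm, of a map that
  sends graphons to kernels.
\<close>

definition cut_norm_continuous :: "((real \<times> real \<Rightarrow> real) \<Rightarrow> (real \<times> real \<Rightarrow> real)) \<Rightarrow> bool" where
  "cut_norm_continuous F \<longleftrightarrow>
     (\<forall>W\<in>graphons. \<forall>\<epsilon>>0. \<exists>\<delta>>0. \<forall>U\<in>graphons.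
        cut_norm (\<lambda>z. U z - W z) < \<delta> \<longrightarrow> cut_norm (\<lambda>z. F U z - F W z) < \<epsilon>)"

end

theory Submission
  imports Defs
begin

text \<open>
  An affine map \<open>a * x + b\<close> scales the cut norm of differences by \<open>\<bar>a\<bar>\<close>, which gives continuity.
  Conversely, for \<open>x, y \<in> [0, 1]\<close> the graphons taking the values \<open>x\<close> and \<open>y\<close> according to the
  sign pattern of the \<open>2^k \<times> 2^k\<close> Walsh--Hadamard matrix converge in cut norm to the constant
  \<open>(x + y) / 2\<close>, because that matrix is orthogonal up to the factor \<open>2^k\<close>; their images under
  \<open>\<rho>\<close> converge to the constant \<open>(\<rho> x + \<rho> y) / 2\<close> in the same way. Hence \<open>\<rho>\<close> preserves midpoints.
  As \<open>\<rho>\<close> is bounded, since its composition with the graphon \<open>s * t\<close> is, it is affine.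
\<close>

section \<open>Bounded functions preserving midpoints\<close>

text \<open>Each point of the interval is the midpoint of an endpoint, where \<open>g\<close>
  vanishes, and another point of the interval. So every value of \<open>g\<close> is half of another
  value, and a uniform bound \<open>M\<close> improves to \<open>M / 2\<close>, then to
  \<open>M / 2 ^ n\<close>.\<close>

lemma bounded_midpoint_zero:
  fixes g :: "real \<Rightarrow> real"
  assumes mid: "\<And>x y. x \<in> {0..1} \<Longrightarrow> y \<in> {0..1} \<Longrightarrow> g ((x + y) / 2) = (g x + g y) / 2"
    and "g 0 = 0" "g 1 = 0"
    and bound: "\<And>x. x \<in> {0..1} \<Longrightarrow> \<bar>g x\<bar> \<le> M"
    and "x \<in> {0..1}"
  shows "g x = 0"
proof -
  have "\<bar>g x\<bar> \<le> M / 2 ^ n" if "x \<in> {0..1}" for x n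
    using that
  proof (induction n arbitrary: x)
    case 0
    then show ?case using bound by simp
  next
    case (Suc n)
    show ?case
    proof (cases "x \<le> 1 / 2")
      case True
      then have "g x = g (2 * x) / 2" "\<bar>g (2 * x)\<bar> \<le> M / 2 ^ n"
        using mid[of 0 "2 * x"] Suc \<open>g 0 = 0\<close> by auto
      then have "\<bar>g x\<bar> \<le> M / 2 ^ n / 2" by (simp only: abs_divide) simp
      then show ?thesis by (simp add: mult.commute)
    next
      case False
      then have "g x = g (2 * x - 1) / 2" "\<bar>g (2 * x - 1)\<bar> \<le> M / 2 ^ n"
        using mid[of 1 "2 * x - 1"] Suc \<open>g 1 = 0\<close> by auto
      then have "\<bar>g x\<bar> \<le> M / 2 ^ n / 2" by (simp only: abs_divide) simp
      then show ?thesis by (simp add: mult.commute)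
    qed
  qed
  then have "\<bar>g x\<bar> \<le> M / 2 ^ n" for n using \<open>x \<in> {0..1}\<close> by blast
  moreover have "(\<lambda>n. M / 2 ^ n) \<longlonglongrightarrow> 0"
    by (rule LIMSEQ_divide_realpow_zero) simp
  ultimately have "\<bar>g x\<bar> \<le> 0"
    by (intro LIMSEQ_le_const) auto
  then show ?thesis by simp
qed

text \<open>Subtracting the chord through the two endpoints keeps boundedness and midpoint
  preservation and makes the function vanish at 0 and 1.\<close>

lemma bounded_midpoint_affine:
  fixes f :: "real \<Rightarrow> real"
  assumes mid: "\<And>x y. x \<in> {0..1} \<Longrightarrow> y \<in> {0..1} \<Longrightarrow> f ((x + y) / 2) = (f x + f y) / 2"
    and bounded: "bounded (f ` {0..1})"
    and x: "x \<in> {0..1}"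
  shows "f x = (f 1 - f 0) * x + f 0"
proof -
  obtain M where M: "\<And>x. x \<in> {0..1} \<Longrightarrow> \<bar>f x\<bar> \<le> M"
    using bounded unfolding bounded_iff by fastforce
  define c where "c = f 1 - f 0"
  have "f x - c * x - f 0 = 0"
  proof (rule bounded_midpoint_zero[where g = "\<lambda>x. f x - c * x - f 0"
        and M = "M + \<bar>c\<bar> + \<bar>f 0\<bar>"])
    fix x :: real assume x: "x \<in> {0..1}"
    then have "\<bar>c * x\<bar> \<le> \<bar>c\<bar> * 1"
      unfolding abs_mult by (intro mult_left_mono) auto
    then show "\<bar>f x - c * x - f 0\<bar> \<le> M + \<bar>c\<bar> + \<bar>f 0\<bar>"
      using M[OF x] by linarith
  next
    fix x y :: real assume "x \<in> {0..1}" "y \<in> {0..1}"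
    then show "f ((x + y) / 2) - c * ((x + y) / 2) - f 0 =
        (f x - c * x - f 0 + (f y - c * y - f 0)) / 2"
      by (simp add: mid field_simps)
  qed (use x c_def in auto)
  then show ?thesis by (simp add: c_def)
qed

section \<open>Walsh--Hadamard matrices\<close>

text \<open>Sylvester's construction, peeling off the lowest binary digit: the entry is -1 to the
  number of positions among the lowest \<open>k\<close> at which \<open>i\<close> and
  \<open>j\<close> both have the digit 1.\<close>

fun hadamard :: "nat \<Rightarrow> nat \<Rightarrow> nat \<Rightarrow> real" where
  "hadamard 0 i j = 1"
| "hadamard (Suc k) i j = hadamard k (i div 2) (j div 2) * (if odd i \<and> odd j then -1 else 1)"

lemma hadamard_sym: "hadamard k i j = hadamard k j i"
  by (induction k arbitrary: i j) auto

lemma hadamard_values: "hadamard k i j = 1 \<or> hadamard k i j = -1"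
proof (induction k arbitrary: i j)
  case (Suc k)
  show ?case using Suc[of "i div 2" "j div 2"] by auto
qed simp

lemma sum_lessThan_double:
  fixes f :: "nat \<Rightarrow> 'a::comm_monoid_add"
  shows "(\<Sum>i<2 * n. f i) = (\<Sum>i<n. f (2 * i) + f (2 * i + 1))"
  by (induction n) (auto simp: algebra_simps)

lemma hadamard_orthogonal:
  assumes "j < 2 ^ k" "j' < 2 ^ k"
  shows "(\<Sum>i<2 ^ k. hadamard k i j * hadamard k i j') = (if j = j' then 2 ^ k else 0)"
  using assms
proof (induction k arbitrary: j j')
  case 0
  then show ?case by simp
next
  case (Suc k)
  \<comment> \<open>The rows \<open>2 * i\<close> and \<open>2 * i + 1\<close> differ only in the
    lowest digit. Together they contribute \<open>?c\<close>, which is 2 if \<open>j\<close> and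
    \<open>j'\<close> have the same parity and 0 otherwise.\<close>
  let ?c = "1 + (if odd j then -1 else 1) * (if odd j' then -1 else 1) :: real"
  have "(\<Sum>i<2 ^ Suc k. hadamard (Suc k) i j * hadamard (Suc k) i j') =
      (\<Sum>i<2 ^ k. hadamard k i (j div 2) * hadamard k i (j' div 2) * ?c)"
    unfolding power_Suc sum_lessThan_double by (intro sum.cong) (auto simp: algebra_simps)
  also have "\<dots> = (if j div 2 = j' div 2 then 2 ^ k else 0) * ?c"
    unfolding sum_distrib_right[symmetric] using Suc.prems by (subst Suc.IH) auto
  also have "\<dots> = (if j = j' then 2 ^ Suc k else 0)"
  proof (cases "j = j'")
    case True
    then show ?thesis by auto
  next
    case False
    then have "j div 2 \<noteq> j' div 2 \<or> even j \<noteq> even j'"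
      by (metis bit_eq_rec)
    with False show ?thesis by auto
  qed
  finally show ?case .
qed

text \<open>Lindsey's lemma in squared form: by orthogonality the matrix multiplies squared
  Euclidean norms by \<open>2 ^ k\<close>, and Cauchy-Schwarz is applied to \<open>x\<close> and the
  image of \<open>y\<close>.\<close>

lemma hadamard_bilinear_bound:
  fixes x y :: "nat \<Rightarrow> real" and k :: nat
  defines "N \<equiv> 2 ^ k :: nat"
  shows "(\<Sum>i<N. \<Sum>j<N. hadamard k i j * (x i * y j))\<^sup>2 \<le>
    2 ^ k * (\<Sum>i<N. (x i)\<^sup>2) * (\<Sum>j<N. (y j)\<^sup>2)"
proof -
  let ?Hy = "\<lambda>i. \<Sum>j<N. hadamard k i j * y j"
  have "(\<Sum>i<N. (?Hy i)\<^sup>2) =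
      (\<Sum>i<N. \<Sum>j<N. \<Sum>j'<N. y j * y j' * (hadamard k i j * hadamard k i j'))"
    by (simp add: power2_eq_square sum_product mult_ac)
  \<comment> \<open>Moving the sum over \<open>i\<close> innermost exposes the inner product of two
    columns.\<close>
  also have "\<dots> = (\<Sum>j<N. \<Sum>j'<N. \<Sum>i<N. y j * y j' * (hadamard k i j * hadamard k i j'))"
    by (subst sum.swap, rule sum.cong[OF refl], rule sum.swap)
  also have "\<dots> = (\<Sum>j<N. \<Sum>j'<N. y j * y j' * (if j = j' then 2 ^ k else 0))"
    unfolding sum_distrib_left[symmetric] N_def
    by (intro sum.cong refl) (simp add: hadamard_orthogonal)
  also have "\<dots> = 2 ^ k * (\<Sum>j<N. (y j)\<^sup>2)"
    by (simp add: sum_distrib_left power2_eq_square mult_ac if_distrib cong: if_cong)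
  finally have Hy: "(\<Sum>i<N. (?Hy i)\<^sup>2) = 2 ^ k * (\<Sum>j<N. (y j)\<^sup>2)" .
  have "(\<Sum>i<N. \<Sum>j<N. hadamard k i j * (x i * y j)) = (\<Sum>i<N. x i * ?Hy i)"
    by (simp add: sum_distrib_left mult_ac)
  then have "(\<Sum>i<N. \<Sum>j<N. hadamard k i j * (x i * y j))\<^sup>2 \<le>
      (\<Sum>i<N. (x i)\<^sup>2) * (\<Sum>i<N. (?Hy i)\<^sup>2)"
    by (simp only: Cauchy_Schwarz_ineq_sum)
  also have "\<dots> = 2 ^ k * (\<Sum>i<N. (x i)\<^sup>2) * (\<Sum>j<N. (y j)\<^sup>2)"
    unfolding Hy by simp
  finally show ?thesis .
qed

section \<open>Integrals over measurable rectangles\<close>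

text \<open>On the product type \<open>lebesgue\<close> is the completion of the product of the
  Borel measures. Hence \<open>A\<close> and \<open>B\<close> are replaced by Borel sets
  \<open>S\<close> and \<open>T\<close> up to null sets; the points of \<open>A \<times> B\<close>
  outside \<open>S \<times> T\<close> lie in the union of two null strips, and the product formula
  for \<open>S \<times> T\<close> carries over.\<close>

lemma lebesgue_Times:
  fixes A :: "'a::euclidean_space set" and B :: "'b::euclidean_space set"
  assumes "A \<in> sets lebesgue" "B \<in> sets lebesgue"
  shows sets_lebesgue_Times: "A \<times> B \<in> sets lebesgue"
    and measure_lebesgue_Times: "measure lebesgue (A \<times> B) = measure lebesgue A * measure lebesgue B"
proof -
  obtain S N N' where A: "A = S \<union> N" "N \<subseteq> N'" "N' \<in> null_sets lborel" "S \<in> sets lborel"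
    using assms(1) by (rule sets_completionE)
  obtain T K K' where B: "B = T \<union> K" "K \<subseteq> K'" "K' \<in> null_sets lborel" "T \<in> sets lborel"
    using assms(2) by (rule sets_completionE)
  have "N' \<times> UNIV \<in> null_sets (lborel \<Otimes>\<^sub>M lborel :: ('a \<times> 'b) measure)"
    using A(3) by (intro lborel.times_in_null_sets1) auto
  moreover have "UNIV \<times> K' \<in> null_sets (lborel \<Otimes>\<^sub>M lborel :: ('a \<times> 'b) measure)"
    using B(3) by (intro lborel.times_in_null_sets2) auto
  ultimately have "N' \<times> UNIV \<union> UNIV \<times> K' \<in> null_sets (lborel :: ('a \<times> 'b) measure)"
    unfolding lborel_prod by (rule null_sets.Un)
  then have null: "A \<times> B - S \<times> T \<in> null_sets lebesgue"
    by (rule null_sets_completion_subset[rotated, OF null_sets_completionI])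
      (use A B in auto)
  have ST: "S \<times> T \<in> sets (lborel :: ('a \<times> 'b) measure)"
    using A(4) B(4) unfolding lborel_prod[symmetric] by auto
  have eq: "S \<times> T \<union> (A \<times> B - S \<times> T) = A \<times> B"
    using A(1) B(1) by auto
  have "S \<times> T \<union> (A \<times> B - S \<times> T) \<in> sets lebesgue"
    using ST null by (intro sets.Un) auto
  then show "A \<times> B \<in> sets lebesgue"
    unfolding eq .
  have "N \<in> null_sets lebesgue" "K \<in> null_sets lebesgue"
    using A(2,3) B(2,3) by (auto intro: null_sets_completion_subset null_sets_completionI)
  then have "measure lebesgue A = measure lborel S" "measure lebesgue B = measure lborel T"
    using A(4) B(4) by (simp_all add: A(1) B(1) measure_Un_null_set)
  moreover have "measure lebesgue (A \<times> B) = measure (lborel :: ('a \<times> 'b) measure) (S \<times> T)"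
    using measure_Un_null_set[OF _ null, of "S \<times> T"] ST unfolding eq by simp
  moreover have "\<dots> = measure lborel S * measure lborel T"
    using A(4) B(4) unfolding lborel_prod[symmetric]
    by (simp add: measure_def lborel.emeasure_pair_measure_Times enn2real_mult)
  ultimately show "measure lebesgue (A \<times> B) = measure lebesgue A * measure lebesgue B"
    by simp
qed

lemma lmeasurable_unit_square: "unit_square \<in> lmeasurable"
  and measure_unit_square: "measure lebesgue unit_square = 1"
proof -
  have eq: "unit_square = cbox (0, 0) (1, 1)"
    by (simp add: unit_square_def cbox_Pair_eq)
  show "unit_square \<in> lmeasurable"
    unfolding eq by (rule lmeasurable_cbox)
  show "measure lebesgue unit_square = 1"
    unfolding unit_square_def by (subst measure_lebesgue_Times) auto
qed

lemma Times_subset_unit_square: "S \<subseteq> {0..1} \<Longrightarrow> T \<subseteq> {0..1} \<Longrightarrow> S \<times> T \<subseteq> unit_square"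
  unfolding unit_square_def by (rule Sigma_mono)

section \<open>Estimates of the cut norm by integrals over rectangles\<close>

lemma abs_set_integral_le:
  fixes f :: "real \<times> real \<Rightarrow> real"
  assumes "R \<subseteq> unit_square" and "\<And>z. z \<in> unit_square \<Longrightarrow> \<bar>f z\<bar> \<le> M"
  shows "\<bar>LINT z:R|lebesgue. f z\<bar> \<le> M"
proof -
  have "0 \<le> M"
    using assms(2)[of "(0, 0)"] by (auto simp: unit_square_def)
  show ?thesis
  proof (cases "set_integrable lebesgue R f")
    case True
    have "\<bar>LINT z:R|lebesgue. f z\<bar> \<le> (LINT z|lebesgue. M * indicator unit_square z)"
      unfolding set_lebesgue_integral_def real_norm_def[symmetric]
    proof (rule Bochner_Integration.integral_norm_bound_integral)
      show "integrable lebesgue (\<lambda>z. M * indicator unit_square z)"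
        using lmeasurable_unit_square
        by (intro integrable_mult_right) (simp add: lmeasurable_iff_integrable)
    qed (use True assms \<open>0 \<le> M\<close> in \<open>auto simp: set_integrable_def indicator_def\<close>)
    also have "\<dots> = M"
      using measure_unit_square by simp
    finally show ?thesis .
  next
    \<comment> \<open>The integral of a non-integrable function is 0 by convention.\<close>
    case False
    then show ?thesis
      using \<open>0 \<le> M\<close>
      by (simp add: set_lebesgue_integral_def set_integrable_def not_integrable_integral_eq)
  qed
qed

text \<open>The pointwise bound \<open>M\<close> makes the family of integrals bounded above, as a
  comparison with a supremum in the reals requires.\<close>

lemma cut_norm_upper:
  assumes "\<And>z. z \<in> unit_square \<Longrightarrow> \<bar>f z\<bar> \<le> M"
    and "S \<in> sets lebesgue" "S \<subseteq> {0..1}" "T \<in> sets lebesgue" "T \<subseteq> {0..1}"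
  shows "\<bar>LINT z:S \<times> T|lebesgue. f z\<bar> \<le> cut_norm f"
proof -
  let ?I = "{(S, T). S \<in> sets lebesgue \<and> S \<subseteq> {0..1} \<and> T \<in> sets lebesgue \<and> T \<subseteq> {0..1::real}}"
  have "bdd_above ((\<lambda>(S, T). \<bar>LINT z:S \<times> T|lebesgue. f z\<bar>) ` ?I)"
    using abs_set_integral_le[OF Times_subset_unit_square assms(1)]
    by (intro bdd_aboveI2[of _ _ M]) auto
  from cSUP_upper[OF _ this, of "(S, T)"] show ?thesis
    using assms by (simp add: cut_norm_def)
qed

lemma cut_norm_least:
  assumes "\<And>S T. S \<in> sets lebesgue \<Longrightarrow> S \<subseteq> {0..1} \<Longrightarrow> T \<in> sets lebesgue \<Longrightarrow> T \<subseteq> {0..1} \<Longrightarrow>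
    \<bar>LINT z:S \<times> T|lebesgue. f z\<bar> \<le> M"
  shows "cut_norm f \<le> M"
  unfolding cut_norm_def by (rule cSUP_least) (use assms in auto)

section \<open>Walsh kernels\<close>

text \<open>
  The cells are the half-open dyadic intervals \<open>(i / 2^k, (i + 1) / 2^k]\<close>; truncation by
  \<^const>\<open>nat\<close> puts the endpoint \<open>0\<close> into the first one.
\<close>

definition dyadic_cell :: "nat \<Rightarrow> real \<Rightarrow> nat" where
  "dyadic_cell k s = nat (\<lceil>2 ^ k * s\<rceil> - 1)"

definition walsh_kernel :: "nat \<Rightarrow> real \<times> real \<Rightarrow> real" where
  "walsh_kernel k z = hadamard k (dyadic_cell k (fst z)) (dyadic_cell k (snd z))"

text \<open>Rounding up and then subtracting 1 places \<open>s = 1\<close> in the last cell, with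
  index \<open>2 ^ k - 1\<close>, so indices stay within the matrix.\<close>

lemma dyadic_cell_less: "s \<in> {0..1} \<Longrightarrow> dyadic_cell k s < 2 ^ k"
proof -
  assume "s \<in> {0..1}"
  then have "\<lceil>2 ^ k * s\<rceil> \<le> 2 ^ k"
    by (simp add: ceiling_le_iff mult_left_le)
  then show ?thesis
    unfolding dyadic_cell_def by (simp add: nat_less_iff)
qed

lemma dyadic_cell_measurable [measurable]: "dyadic_cell k \<in> borel \<rightarrow>\<^sub>M count_space UNIV"
  unfolding dyadic_cell_def[abs_def] by measurable

lemma walsh_kernel_measurable: "walsh_kernel k \<in> borel_measurable borel"
proof -
  have "(\<lambda>z. hadamard k (dyadic_cell k (fst z)) (dyadic_cell k (snd z)))
      \<in> borel_measurable (borel \<Otimes>\<^sub>M borel)"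
    by measurable
  then show ?thesis
    unfolding walsh_kernel_def[abs_def] borel_prod .
qed

lemma dyadic_cell_sets:
  "S \<in> sets lebesgue \<Longrightarrow> S \<inter> dyadic_cell k -` {i} \<in> sets lebesgue"
proof -
  have "dyadic_cell k -` {i} \<in> sets borel"
    using measurable_sets[OF dyadic_cell_measurable, of "{i}" k] by simp
  then show "S \<in> sets lebesgue \<Longrightarrow> ?thesis" by auto
qed

lemma measure_dyadic_cell_le:
  assumes "S \<subseteq> {0..1}" "S \<in> sets lebesgue"
  shows "measure lebesgue (S \<inter> dyadic_cell k -` {i}) \<le> 1 / 2 ^ k"
proof -
  \<comment> \<open>The closed interval also covers the point 0, which truncation adds to cell 0.
    Negative \<open>s\<close>, which truncation would put there too, are excluded by
    \<open>S \<subseteq> {0..1}\<close>.\<close>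
  have "S \<inter> dyadic_cell k -` {i} \<subseteq> {i / 2 ^ k .. (i + 1) / 2 ^ k}"
  proof
    fix s assume "s \<in> S \<inter> dyadic_cell k -` {i}"
    then have s: "0 \<le> 2 ^ k * s" "i = nat (\<lceil>2 ^ k * s\<rceil> - 1)"
      using assms by (auto simp: dyadic_cell_def)
    then have "real i \<le> 2 ^ k * s" "2 ^ k * s \<le> real i + 1"
      by linarith+
    then show "s \<in> {i / 2 ^ k .. (i + 1) / 2 ^ k}"
      by (simp add: field_simps)
  qed
  then have "measure lebesgue (S \<inter> dyadic_cell k -` {i}) \<le>
      measure lebesgue {i / 2 ^ k .. (i + 1) / 2 ^ k}"
    by (rule measure_mono_fmeasurable) (use assms dyadic_cell_sets in auto)
  also have "\<dots> = 1 / 2 ^ k"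
    by (simp add: field_simps)
  finally show ?thesis .
qed

text \<open>The kernel is constant on products of cells, so its integral over a rectangle is the
  bilinear form of the matrix at the vectors of masses that \<open>S\<close> and \<open>T\<close>
  have in the cells.\<close>

lemma walsh_kernel_integral:
  fixes k :: nat
  assumes S: "S \<in> sets lebesgue" "S \<subseteq> {0..1}" and T: "T \<in> sets lebesgue" "T \<subseteq> {0..1}"
  defines "\<mu> \<equiv> \<lambda>A i. measure lebesgue (A \<inter> dyadic_cell k -` {i})"
  shows "(LINT z:S \<times> T|lebesgue. walsh_kernel k z) =
    (\<Sum>i<2 ^ k. \<Sum>j<2 ^ k. hadamard k i j * (\<mu> S i * \<mu> T j))"
proof -
  let ?R = "\<lambda>i j. (S \<inter> dyadic_cell k -` {i}) \<times> (T \<inter> dyadic_cell k -` {j})"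
  \<comment> \<open>The sets \<open>?R i j\<close> partition \<open>S \<times> T\<close>, so at each
    point of it exactly one term survives.\<close>
  have ind: "indicator (S \<times> T) z * walsh_kernel k z =
      (\<Sum>i<2 ^ k. \<Sum>j<2 ^ k. hadamard k i j * indicator (?R i j) z)" for z
  proof (cases "z \<in> S \<times> T")
    case True
    then obtain s t where z: "z = (s, t)" "s \<in> S" "t \<in> T" by blast
    let ?i = "dyadic_cell k s" and ?j = "dyadic_cell k t"
    have less: "?i < 2 ^ k" "?j < 2 ^ k"
      using z S(2) T(2) by (blast intro: dyadic_cell_less)+
    have "(\<Sum>j<2 ^ k. hadamard k i j * indicator (?R i j) z) =
        (if i = ?i then hadamard k i ?j else 0)" for i
    proof -
      have "(\<Sum>j<2 ^ k. hadamard k i j * indicator (?R i j) z) =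
          (\<Sum>j<2 ^ k. if j = ?j then if i = ?i then hadamard k i j else 0 else 0)"
        by (rule sum.cong) (simp_all add: z indicator_def)
      then show ?thesis using less by simp
    qed
    then have "(\<Sum>i<2 ^ k. \<Sum>j<2 ^ k. hadamard k i j * indicator (?R i j) z) = hadamard k ?i ?j"
      using less by simp
    then show ?thesis
      using True by (simp add: walsh_kernel_def z)
  next
    case False
    then have "\<And>i j. z \<notin> ?R i j" by auto
    with False show ?thesis by simp
  qed
  have "?R i j \<in> lmeasurable" for i j
  proof (rule fmeasurableI2[OF lmeasurable_unit_square])
    show "?R i j \<subseteq> unit_square" using S T by (intro Times_subset_unit_square) auto
    show "?R i j \<in> sets lebesgue" by (intro sets_lebesgue_Times dyadic_cell_sets S T)
  qed
  then have int: "integrable lebesgue (\<lambda>z. hadamard k i j * indicator (?R i j) z)" for i j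
    unfolding lmeasurable_iff_integrable by (rule integrable_mult_right)
  have "(LINT z:S \<times> T|lebesgue. walsh_kernel k z) =
      (\<Sum>i<2 ^ k. \<Sum>j<2 ^ k. LINT z|lebesgue. hadamard k i j * indicator (?R i j) z)"
    unfolding set_lebesgue_integral_def real_scaleR_def ind
    by (simp only: Bochner_Integration.integral_sum Bochner_Integration.integrable_sum int)
  also have "\<dots> = (\<Sum>i<2 ^ k. \<Sum>j<2 ^ k. hadamard k i j * (\<mu> S i * \<mu> T j))"
    by (simp add: \<mu>_def measure_lebesgue_Times dyadic_cell_sets S T)
  finally show ?thesis .
qed

text \<open>Each of the \<open>2 ^ k\<close> cells carries mass at most \<open>1 / 2 ^ k\<close>, so
  both mass vectors have squared norm at most \<open>1 / 2 ^ k\<close>, and Lindsey's bound applies.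
  The estimate is uniform in \<open>S\<close> and \<open>T\<close>, hence controls the cut
  norm.\<close>

lemma walsh_kernel_integral_le:
  assumes S: "S \<in> sets lebesgue" "S \<subseteq> {0..1}" and T: "T \<in> sets lebesgue" "T \<subseteq> {0..1}"
  shows "\<bar>LINT z:S \<times> T|lebesgue. walsh_kernel k z\<bar> \<le> sqrt (1 / 2 ^ k)"
proof (rule real_le_rsqrt)
  define \<mu> where "\<mu> A i = measure lebesgue (A \<inter> dyadic_cell k -` {i})" for A i
  have sum_le: "(\<Sum>i<2 ^ k. (\<mu> A i)\<^sup>2) \<le> 1 / 2 ^ k" if "A \<in> sets lebesgue" "A \<subseteq> {0..1}" for A
  proof -
    have "(\<Sum>i<2 ^ k. (\<mu> A i)\<^sup>2) \<le> (\<Sum>i<2 ^ k :: nat. (1 / 2 ^ k)\<^sup>2)"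
      unfolding \<mu>_def using that by (intro sum_mono power_mono measure_dyadic_cell_le) auto
    also have "\<dots> = 1 / 2 ^ k"
      by (simp add: power2_eq_square)
    finally show ?thesis .
  qed
  have "(LINT z:S \<times> T|lebesgue. walsh_kernel k z)\<^sup>2 \<le>
      2 ^ k * (\<Sum>i<2 ^ k. (\<mu> S i)\<^sup>2) * (\<Sum>j<2 ^ k. (\<mu> T j)\<^sup>2)"
    unfolding walsh_kernel_integral[OF assms] \<mu>_def by (rule hadamard_bilinear_bound)
  also have "\<dots> \<le> 2 ^ k * (1 / 2 ^ k) * (1 / 2 ^ k)"
    by (intro mult_mono sum_le S T) (auto intro: sum_nonneg)
  finally show "\<bar>LINT z:S \<times> T|lebesgue. walsh_kernel k z\<bar>\<^sup>2 \<le> 1 / 2 ^ k"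
    by simp
qed

section \<open>Continuity in the cut norm\<close>

lemma borel_graphon:
  assumes "W \<in> borel_measurable borel" "\<And>z. z \<in> unit_square \<Longrightarrow> W z \<in> {0..1}"
    and "\<And>x y. W (x, y) = W (y, x)"
  shows "W \<in> graphons"
proof -
  have "W \<in> borel_measurable (lebesgue_on unit_square)"
    using assms(1) by (intro measurable_restrict_space1 measurable_completion) simp
  moreover have "bounded (W ` unit_square)"
    using assms(2) by (intro boundedI[of _ 1]) fastforce
  ultimately show ?thesis
    using assms(2,3) by (auto simp: graphons_def kernels_def)
qed

lemma continuous_affine:
  fixes \<rho> :: "real \<Rightarrow> real"
  assumes affine: "\<And>x. x \<in> {0..1} \<Longrightarrow> \<rho> x = a * x + b"
  shows "cut_norm_continuous (\<lambda>W. \<rho> \<circ> W)"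
  unfolding cut_norm_continuous_def
proof (intro ballI allI impI)
  fix W and \<epsilon> :: real assume W: "W \<in> graphons" and \<epsilon>: "\<epsilon> > 0"
  show "\<exists>\<delta>>0. \<forall>U\<in>graphons. cut_norm (\<lambda>z. U z - W z) < \<delta> \<longrightarrow>
      cut_norm (\<lambda>z. (\<rho> \<circ> U) z - (\<rho> \<circ> W) z) < \<epsilon>"
  \<comment> \<open>Adding 1 keeps the denominator positive when \<open>a = 0\<close>.\<close>
  proof (intro exI[of _ "\<epsilon> / (\<bar>a\<bar> + 1)"] conjI ballI impI)
    show "\<epsilon> / (\<bar>a\<bar> + 1) > 0" using \<epsilon> by simp
  next
    fix U assume U: "U \<in> graphons" and less: "cut_norm (\<lambda>z. U z - W z) < \<epsilon> / (\<bar>a\<bar> + 1)"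
    have vals: "U z \<in> {0..1}" "W z \<in> {0..1}" if "z \<in> unit_square" for z
      using U W that by (auto simp: graphons_def)
    have bound: "\<bar>U z - W z\<bar> \<le> 1" if "z \<in> unit_square" for z
      using vals[OF that] by auto
    \<comment> \<open>The empty rectangle gives the lower bound 0, which is what allows
      \<open>\<bar>a\<bar>\<close> to be enlarged to \<open>\<bar>a\<bar> + 1\<close> below.\<close>
    have "0 \<le> cut_norm (\<lambda>z. U z - W z)"
      using cut_norm_upper[of "\<lambda>z. U z - W z" 1 "{}" "{}"] bound by simp
    have "cut_norm (\<lambda>z. (\<rho> \<circ> U) z - (\<rho> \<circ> W) z) \<le> \<bar>a\<bar> * cut_norm (\<lambda>z. U z - W z)"
    proof (rule cut_norm_least)
      fix S T :: "real set"
      assume ST: "S \<in> sets lebesgue" "S \<subseteq> {0..1}" "T \<in> sets lebesgue" "T \<subseteq> {0..1}"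
      then have "S \<times> T \<subseteq> unit_square" by (intro Times_subset_unit_square)
      then have "(LINT z:S \<times> T|lebesgue. (\<rho> \<circ> U) z - (\<rho> \<circ> W) z) =
          (LINT z:S \<times> T|lebesgue. a * (U z - W z))"
        using vals sets_lebesgue_Times[OF ST(1,3)]
        by (intro set_lebesgue_integral_cong) (auto simp: affine subset_iff algebra_simps)
      then show "\<bar>LINT z:S \<times> T|lebesgue. (\<rho> \<circ> U) z - (\<rho> \<circ> W) z\<bar> \<le>
          \<bar>a\<bar> * cut_norm (\<lambda>z. U z - W z)"
        using cut_norm_upper[OF bound ST] by (simp add: abs_mult mult_left_mono)
    qed
    also have "\<dots> \<le> (\<bar>a\<bar> + 1) * cut_norm (\<lambda>z. U z - W z)"
      using \<open>0 \<le> cut_norm _\<close> by (intro mult_right_mono) auto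
    also have "\<dots> < \<epsilon>"
      using less by (simp add: field_simps)
    finally show "cut_norm (\<lambda>z. (\<rho> \<circ> U) z - (\<rho> \<circ> W) z) < \<epsilon>" .
  qed
qed

text \<open>Any function of a sign is affine in that sign, so applying \<open>\<rho>\<close> to
  \<open>U k\<close> and subtracting its value at the midpoint leaves a constant \<open>m\<close>
  plus a multiple of the Walsh kernel. The multiple tends to 0 in cut norm while the constant has
  cut norm \<open>\<bar>m\<bar>\<close>, so continuity at the constant graphon forces
  \<open>m = 0\<close>.\<close>

lemma continuous_preserves_midpoints:
  fixes \<rho> :: "real \<Rightarrow> real"
  assumes cont: "cut_norm_continuous (\<lambda>W. \<rho> \<circ> W)"
    and x: "x \<in> {0..1}" and y: "y \<in> {0..1}"
  shows "\<rho> ((x + y) / 2) = (\<rho> x + \<rho> y) / 2"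
proof -
  \<comment> \<open>\<open>m\<close> is the midpoint defect to be shown zero, and \<open>d\<close>
    is the amplitude of the oscillation about the mean of \<open>\<rho> x\<close> and
    \<open>\<rho> y\<close>.\<close>
  define m where "m = (\<rho> x + \<rho> y) / 2 - \<rho> ((x + y) / 2)"
  define d where "d = (\<rho> x - \<rho> y) / 2"
  define U where "U k z = (x + y) / 2 + (x - y) / 2 * walsh_kernel k z" for k z
  let ?W = "\<lambda>_ :: real \<times> real. (x + y) / 2"
  have sign: "walsh_kernel k z = 1 \<or> walsh_kernel k z = -1" for k z
    unfolding walsh_kernel_def by (rule hadamard_values)
  have U: "U k \<in> graphons" for k
  proof (rule borel_graphon)
    show "U k \<in> borel_measurable borel"
      unfolding U_def[abs_def] using walsh_kernel_measurable by measurable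
    show "U k z \<in> {0..1}" for z
      using sign[of k z] x y by (auto simp: U_def field_simps)
    show "U k (s, t) = U k (t, s)" for s t
      by (simp add: U_def walsh_kernel_def hadamard_sym[of k "dyadic_cell k s"])
  qed
  have W: "?W \<in> graphons"
    using x y by (intro borel_graphon) auto
  have \<rho>U: "(\<rho> \<circ> U k) z - (\<rho> \<circ> ?W) z = m + d * walsh_kernel k z" for k z
    using sign[of k z] by (auto simp: U_def m_def d_def field_simps)
  have lim: "(\<lambda>k. sqrt (1 / 2 ^ k)) \<longlonglongrightarrow> 0"
  proof -
    have "(\<lambda>k. sqrt ((1 / 2) ^ k)) \<longlonglongrightarrow> sqrt 0"
      by (intro tendsto_real_sqrt LIMSEQ_realpow_zero) auto
    then show ?thesis by (simp add: power_one_over)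
  qed
  have "\<bar>m\<bar> \<le> \<epsilon>" if "\<epsilon> > 0" for \<epsilon>
  proof -
    obtain \<delta> where "\<delta> > 0" and \<delta>: "\<And>V. V \<in> graphons \<Longrightarrow> cut_norm (\<lambda>z. V z - ?W z) < \<delta> \<Longrightarrow>
        cut_norm (\<lambda>z. (\<rho> \<circ> V) z - (\<rho> \<circ> ?W) z) < \<epsilon>"
      using cont[unfolded cut_norm_continuous_def, rule_format, OF W \<open>\<epsilon> > 0\<close>] by blast
    have "eventually (\<lambda>k. sqrt (1 / 2 ^ k) < \<delta>) sequentially"
      using lim \<open>\<delta> > 0\<close> by (rule order_tendstoD)
    then have "eventually (\<lambda>k. \<bar>m\<bar> \<le> \<epsilon> + \<bar>d\<bar> * sqrt (1 / 2 ^ k)) sequentially"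
    proof eventually_elim
      case (elim k)
      have "cut_norm (\<lambda>z. U k z - ?W z) \<le> sqrt (1 / 2 ^ k)"
      proof (rule cut_norm_least)
        fix S T :: "real set"
        assume ST: "S \<in> sets lebesgue" "S \<subseteq> {0..1}" "T \<in> sets lebesgue" "T \<subseteq> {0..1}"
        have "\<bar>LINT z:S \<times> T|lebesgue. U k z - ?W z\<bar> =
            \<bar>(x - y) / 2\<bar> * \<bar>LINT z:S \<times> T|lebesgue. walsh_kernel k z\<bar>"
          unfolding U_def add_diff_cancel_left' set_integral_mult_right abs_mult ..
        \<comment> \<open>Two points of the unit interval differ by at most 1, so the amplitude is
          at most 1.\<close>
        also have "\<dots> \<le> 1 * sqrt (1 / 2 ^ k)"
          using x y by (intro mult_mono walsh_kernel_integral_le ST) auto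
        finally show "\<bar>LINT z:S \<times> T|lebesgue. U k z - ?W z\<bar> \<le> sqrt (1 / 2 ^ k)" by simp
      qed
      with elim have "cut_norm (\<lambda>z. m + d * walsh_kernel k z) < \<epsilon>"
        using \<delta>[OF U] unfolding \<rho>U by fastforce
      moreover have "\<bar>m + d * walsh_kernel k z\<bar> \<le> \<bar>m\<bar> + \<bar>d\<bar>" for z
        using sign[of k z] by auto
      \<comment> \<open>Testing the cut norm on the whole square, which has measure 1, recovers
        \<open>m\<close> up to the small integral of the oscillating term.\<close>
      then have "\<bar>LINT z:{0..1} \<times> {0..1}|lebesgue. m + d * walsh_kernel k z\<bar> \<le>
          cut_norm (\<lambda>z. m + d * walsh_kernel k z)"
        by (intro cut_norm_upper) auto
      moreover have "(LINT z:{0..1} \<times> {0..1}|lebesgue. m + d * walsh_kernel k z) =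
          m + d * (LINT z:{0..1} \<times> {0..1}|lebesgue. walsh_kernel k z)"
      proof -
        \<comment> \<open>Splitting the integral of the sum calls for integrability of both
          summands; the Walsh kernel is dominated by the constant 1.\<close>
        have const: "set_integrable lebesgue unit_square (\<lambda>_. c)" for c :: real
          using lmeasurable_unit_square by (simp add: set_integrable_def lmeasurable_iff_integrable)
        have "walsh_kernel k \<in> borel_measurable lebesgue"
          using walsh_kernel_measurable by (intro measurable_completion) simp
        moreover have "\<bar>walsh_kernel k z\<bar> \<le> 1" for z
          using sign[of k z] by auto
        ultimately have "set_integrable lebesgue unit_square (walsh_kernel k)"
          using lmeasurable_unit_square
          by (intro set_integrable_bound[OF const[of 1]])
            (auto simp: set_borel_measurable_def fmeasurable_def intro!: AE_I2)
        then show ?thesis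
          using const[of m] measure_unit_square lmeasurable_unit_square
          unfolding unit_square_def[symmetric]
          by (simp add: set_lebesgue_integral_def set_integrable_def algebra_simps)
      qed
      moreover have "\<bar>d * (LINT z:{0..1} \<times> {0..1}|lebesgue. walsh_kernel k z)\<bar> \<le>
          \<bar>d\<bar> * sqrt (1 / 2 ^ k)"
        unfolding abs_mult by (intro mult_left_mono walsh_kernel_integral_le) auto
      ultimately show ?case by linarith
    qed
    \<comment> \<open>For fixed \<open>\<epsilon>\<close>, letting \<open>k\<close> tend to infinity
      removes the term with \<open>d\<close>.\<close>
    moreover have "(\<lambda>k. \<epsilon> + \<bar>d\<bar> * sqrt (1 / 2 ^ k)) \<longlonglongrightarrow> \<epsilon> + \<bar>d\<bar> * 0"
      by (intro tendsto_intros lim)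
    ultimately show ?thesis
      by (intro tendsto_lowerbound[of "\<lambda>k. \<epsilon> + \<bar>d\<bar> * sqrt (1 / 2 ^ k)"]) auto
  qed
  then have "\<bar>m\<bar> \<le> 0" by (rule field_le_epsilon) simp
  then show ?thesis by (simp add: m_def)
qed

theorem proposition5p1:
  fixes \<rho> :: "real \<Rightarrow> real"
  assumes "\<And>W. W \<in> graphons \<Longrightarrow> \<rho> \<circ> W \<in> kernels"
  shows "cut_norm_continuous (\<lambda>W. \<rho> \<circ> W) \<longleftrightarrow> (\<exists>a b. \<forall>x\<in>{0..1}. \<rho> x = a * x + b)"
proof
  assume cont: "cut_norm_continuous (\<lambda>W. \<rho> \<circ> W)"
  \<comment> \<open>This graphon takes every value of the unit interval, already on the edge where
    the second coordinate is 1, so boundedness of the kernel \<open>\<rho> \<circ> ?W\<close> passes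
    to \<open>\<rho>\<close>.\<close>
  let ?W = "\<lambda>z :: real \<times> real. fst z * snd z"
  have "?W \<in> graphons"
  proof (rule borel_graphon)
    show "?W \<in> borel_measurable borel"
      unfolding borel_prod[symmetric] by measurable
  qed (auto simp: unit_square_def mult_le_one)
  then have "bounded ((\<rho> \<circ> ?W) ` unit_square)"
    using assms by (auto simp: kernels_def)
  moreover have "\<rho> ` {0..1} \<subseteq> (\<rho> \<circ> ?W) ` unit_square"
  proof
    fix r assume "r \<in> \<rho> ` {0..1}"
    then obtain x where "x \<in> {0..1}" "r = (\<rho> \<circ> ?W) (x, 1)" by auto
    then show "r \<in> (\<rho> \<circ> ?W) ` unit_square"
      by (intro image_eqI[of _ _ "(x, 1)"]) (auto simp: unit_square_def)
  qed
  ultimately have "bounded (\<rho> ` {0..1})"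
    by (rule bounded_subset)
  then show "\<exists>a b. \<forall>x\<in>{0..1}. \<rho> x = a * x + b"
    using bounded_midpoint_affine continuous_preserves_midpoints[OF cont] by metis
qed (use continuous_affine in blast)

end
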